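(* Let $A\in\mathbb{R}^{m\times n}$ with $m\ge n$, $b\in\mathbb{R}^m$, let $J=\mathrm{diag}(I_p,-I_q)$ with $p+q=m$, and assume $M=A^TJA$ is positive definite. Let $x=x(A,b)=M^{-1}A^TJb$, $r=b-Ax$, and let $L\in\mathbb{R}^{n\times k}$ ($k\le n$) be fixed. Let $\Psi\in\mathbb{R}^{m\times n}$, $\beta\in\mathbb{R}^m$, $\xi\in\mathbb{R}^k$ be parameters. Then the partial unified condition number $\kappa_{ILS}(A,b)$ of the indefinite least squares problem with respect to $L$ (defined in the context) is $$\kappa_{ILS}(A,b)=\left\|\mathrm{diag}^{\ddag}(\xi)\,M_{g'}\,\mathrm{diag}(\mathrm{vec}(\Psi,\beta))\right\|_{\mu,\nu},$$ where $$M_{g'}=\left[\left((Jr)^T\otimes(L^TM^{-1})\right)\Pi_{mn}-x^T\otimes(L^TM^{-1}A^TJ),\ \ L^TM^{-1}A^TJ\right]\in\mathbb{R}^{k\times(mn+m)}$$ and $\|\cdot\|_{\mu,\nu}$ is the matrix norm induced by the vector norms $\|\cdot\|_\mu$ (on $\mathbb{R}^{mn+m}$) and $\|\cdot\|_\nu$ (on $\mathbb{R}^k$), i.e. $\|N\|_{\mu,\nu}=\sup_{y\ne 0}\|Ny\|_\nu/\|y\|_\mu$.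
   Context: The indefinite least squares (ILS) problem is $\min_{x\in\mathbb{R}^n}(b-Ax)^TJ(b-Ax)$; when $A^TJA$ is positive definite its unique solution is $x(A,b)=M^{-1}A^TJb$. Notation: for $c\in\mathbb{R}$, $c^{\ddag}=1/c$ if $c\neq 0$ and $c^{\ddag}=1$ if $c=0$. For a vector $v$, $\mathrm{diag}(v)$ is the diagonal matrix with diagonal $v$, and $\mathrm{diag}^{\ddag}(v)$ is the diagonal matrix with diagonal entries $v_i^{\ddag}$. Entry-wise division of vectors is $\frac{a}{v}=\mathrm{diag}^{\ddag}(v)a$, and similarly entry-wise for matrices of equal size. $\mathrm{vec}$ stacks the columns of a matrix; $\mathrm{vec}(\Psi,\beta)$ is the vector obtained by stacking $\mathrm{vec}(\Psi)$ on top of $\beta$ (same convention for other pairs). $\otimes$ is the Kronecker product. $\Pi_{mn}\in\mathbb{R}^{mn\times mn}$ is the vec-permutation matrix with $\Pi_{mn}\mathrm{vec}(X)=\mathrm{vec}(X^T)$ for all $X\in\mathbb{R}^{m\times n}$. Let $g(A,b)=L^Tx(A,b)=L^TM^{-1}A^TJb$, and let $g'(A,b)$ be its Fréchet derivative at $(A,b)$, which is $$g'(A,b)\circ(\Delta A,\Delta b)=L^TM^{-1}(\Delta A)^TJr-L^TM^{-1}A^TJ(\Delta A)x+L^TM^{-1}A^TJ\,\Delta b .$$ The partial unified condition number is $$\kappa_{ILS}(A,b)=\sup_{\left\|\mathrm{vec}\left(\frac{\Delta A}{\Psi},\frac{\Delta b}{\beta}\right)\right\|_\mu\neq 0}\frac{\left\|\frac{g'(A,b)\circ(\Delta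 A,\Delta b)}{\xi}\right\|_\nu}{\left\|\mathrm{vec}\left(\frac{\Delta A}{\Psi},\frac{\Delta b}{\beta}\right)\right\|_\mu},$$ the supremum being over $\Delta A\in\mathbb{R}^{m\times n}$, $\Delta b\in\mathbb{R}^m$, with the requirement that if some entry of $\Psi$ or $\beta$ is zero, the corresponding entry of $\Delta A$ or $\Delta b$ is zero.
   Formalization: Added assumption: setting to zero the coordinates of y where vec(Ψ,β) is zero does not increase ‖y‖_μ (automatic if no parameter is zero or if the norm is absolute, e.g. a p-norm); without it the equality can fail for zero parameters. *)

theory Defs
  imports "HOL-Analysis.Analysis"
begin

text \<open>An \<open>m \<times> n\<close> matrix is an element of \<open>real^'n^'m\<close> (rows indexed by \<open>'m\<close>).
  Stacked objects are indexed by products and sums of index types: the columns of an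
  \<open>m \<times> n\<close> matrix stacked on top of each other form a vector over \<open>'n \<times> 'm\<close>, whose entry
  \<open>(j, i)\<close> is entry \<open>i\<close> of column \<open>j\<close>; a vector of length \<open>mn + m\<close> lives over
  \<open>('n \<times> 'm) + 'm\<close>.\<close>

definition ddag :: "real \<Rightarrow> real" where
  "ddag c = (if c = 0 then 1 else 1 / c)"

definition diag :: "real^'a \<Rightarrow> real^'a^'a" where
  "diag v = (\<chi> i j. if i = j then v $ i else 0)"

definition diag_ddag :: "real^'a \<Rightarrow> real^'a^'a" where
  "diag_ddag v = diag (\<chi> i. ddag (v $ i))"

definition vdiv :: "real^'a \<Rightarrow> real^'a \<Rightarrow> real^'a" where
  "vdiv a v = diag_ddag v *v a"

definition mdiv :: "real^'n^'m \<Rightarrow> real^'n^'m \<Rightarrow> real^'n^'m" where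
  "mdiv X Y = (\<chi> i j. ddag (Y $ i $ j) * X $ i $ j)"

definition vec_mat :: "real^'n^'m \<Rightarrow> real^('n \<times> 'm)" where
  "vec_mat X = (\<chi> c. X $ snd c $ fst c)"

definition vec_pair :: "real^'n^'m \<Rightarrow> real^'m \<Rightarrow> real^(('n \<times> 'm) + 'm)" where
  "vec_pair X b = (\<chi> c. case c of Inl d \<Rightarrow> vec_mat X $ d | Inr i \<Rightarrow> b $ i)"

definition hcat :: "real^'a^'k \<Rightarrow> real^'b^'k \<Rightarrow> real^('a + 'b)^'k" where
  "hcat P Q = (\<chi> i c. case c of Inl a \<Rightarrow> P $ i $ a | Inr b \<Rightarrow> Q $ i $ b)"

definition kron :: "real^'c^'a \<Rightarrow> real^'d^'b \<Rightarrow> real^('c \<times> 'd)^('a \<times> 'b)" where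
  "kron B C = (\<chi> i j. B $ fst i $ fst j * C $ snd i $ snd j)"

text \<open>\<open>u\<^sup>T \<otimes> C\<close>: the row index type \<open>1 \<times> 'k\<close> of the Kronecker product with a one-row matrix is
  identified with \<open>'k\<close>.\<close>

definition row_kron :: "real^'a \<Rightarrow> real^'d^'k \<Rightarrow> real^('a \<times> 'd)^'k" where
  "row_kron u C = (\<chi> i. kron (rowvector u :: real^'a^1) C $ (1, i))"

definition vec_perm :: "real^('n::finite \<times> 'm::finite)^('m \<times> 'n)" where
  "vec_perm = (THE P. \<forall>X :: real^'n^'m. P *v vec_mat X = vec_mat (transpose X))"

lemma vec_perm_unique:
  "\<exists>!P :: real^('n::finite \<times> 'm::finite)^('m \<times> 'n). \<forall>X :: real^'n^'m. P *v vec_mat X = vec_mat (transpose X)"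
proof (rule ex_ex1I)
  let ?P = "(\<chi> c d. if d = (snd c, fst c) then 1 else 0) :: real^('n \<times> 'm)^('m \<times> 'n)"
  have "?P *v vec_mat X = vec_mat (transpose X)" for X :: "real^'n^'m"
    by (simp add: vec_eq_iff matrix_vector_mult_def vec_mat_def transpose_def
        if_distrib[of "\<lambda>t. t * _"] cong: if_cong)
  then show "\<exists>P :: real^('n \<times> 'm)^('m \<times> 'n). \<forall>X :: real^'n^'m. P *v vec_mat X = vec_mat (transpose X)"
    by blast
next
  fix P Q :: "real^('n \<times> 'm)^('m \<times> 'n)"
  assume P: "\<forall>X :: real^'n^'m. P *v vec_mat X = vec_mat (transpose X)"
    and Q: "\<forall>X :: real^'n^'m. Q *v vec_mat X = vec_mat (transpose X)"
  have "P *v y = Q *v y" for y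
  proof -
    have "y = vec_mat (\<chi> i j. y $ (j, i))"
      by (simp add: vec_eq_iff vec_mat_def)
    then show ?thesis using P Q by metis
  qed
  then show "P = Q" by (simp add: matrix_eq)
qed

lemma vec_perm_vec_mat: "vec_perm *v vec_mat X = vec_mat (transpose X)"
  using theI'[OF vec_perm_unique] unfolding vec_perm_def by blast

definition pos_def :: "real^'n^'n \<Rightarrow> bool" where
  "pos_def M \<longleftrightarrow> transpose M = M \<and> (\<forall>z. z \<noteq> 0 \<longrightarrow> z \<bullet> (M *v z) > 0)"

text \<open>\<open>J = diag(I\<^sub>p, -I\<^sub>q)\<close> when the \<open>p + q\<close> row indices are numbered \<open>0, 1, \<dots>\<close> by \<open>rho\<close>.\<close>

definition signature :: "('m \<Rightarrow> nat) \<Rightarrow> nat \<Rightarrow> real^'m^'m" where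
  "signature rho p = diag (\<chi> i. if rho i < p then 1 else - 1)"

definition ils_M :: "real^'m^'m \<Rightarrow> real^'n^'m \<Rightarrow> real^'n^'n" where
  "ils_M J A = transpose A ** J ** A"

definition ils_sol :: "real^'m^'m \<Rightarrow> real^'n^'m \<Rightarrow> real^'m \<Rightarrow> real^'n" where
  "ils_sol J A b = (matrix_inv (ils_M J A) ** transpose A ** J) *v b"

definition ils_g :: "real^'m^'m \<Rightarrow> real^'k^'n \<Rightarrow> (real^'n^'m) \<times> (real^'m) \<Rightarrow> real^'k" where
  "ils_g J L = (\<lambda>(A, b). transpose L *v ils_sol J A b)"

definition is_vector_norm :: "(real^'a \<Rightarrow> real) \<Rightarrow> bool" where
  "is_vector_norm f \<longleftrightarrow>
     (\<forall>y. f y \<ge> 0) \<and> (\<forall>y. f y = 0 \<longleftrightarrow> y = 0) \<and>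
     (\<forall>c y. f (c *\<^sub>R y) = \<bar>c\<bar> * f y) \<and> (\<forall>y z. f (y + z) \<le> f y + f z)"

text \<open>Suprema of the nonnegative quotients are taken in \<open>[0, \<infinity>]\<close>, so that the supremum over the
  empty set (all parameters zero) is 0.\<close>

definition induced_norm ::
  "(real^'a \<Rightarrow> real) \<Rightarrow> (real^'k \<Rightarrow> real) \<Rightarrow> real^'a^'k \<Rightarrow> ennreal" where
  "induced_norm mu nu N = (SUP y \<in> {y. y \<noteq> 0}. ennreal (nu (N *v y) / mu y))"

definition kappa_ILS ::
  "(real^(('n \<times> 'm) + 'm) \<Rightarrow> real) \<Rightarrow> (real^'k \<Rightarrow> real) \<Rightarrow>
   real^'n^'m \<Rightarrow> real^'m \<Rightarrow> real^'k \<Rightarrow>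
   real^'m^'m \<Rightarrow> real^'k^'n \<Rightarrow> real^'n^'m \<Rightarrow> real^'m \<Rightarrow> ennreal" where
  "kappa_ILS mu nu Psi beta xi J L A b =
     (SUP (dA, db) \<in> {(dA, db).
          (\<forall>i j. Psi $ i $ j = 0 \<longrightarrow> dA $ i $ j = 0) \<and>
          (\<forall>i. beta $ i = 0 \<longrightarrow> db $ i = 0) \<and>
          mu (vec_pair (mdiv dA Psi) (vdiv db beta)) \<noteq> 0}.
        ennreal (nu (vdiv (frechet_derivative (ils_g J L) (at (A, b)) (dA, db)) xi) /
                 mu (vec_pair (mdiv dA Psi) (vdiv db beta))))"

definition M_g' ::
  "real^'m^'m \<Rightarrow> real^'k^'n \<Rightarrow> real^'n^'m \<Rightarrow> real^'m \<Rightarrow> real^(('n \<times> 'm) + 'm)^'k" where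
  "M_g' J L A b =
     (let Mi = matrix_inv (ils_M J A); x = ils_sol J A b; r = b - A *v x;
          G = transpose L ** Mi ** transpose A ** J
      in hcat (row_kron (J *v r) (transpose L ** Mi) ** vec_perm - row_kron x G) G)"

text \<open>Scaled admissible perturbations vanish wherever the parameter vector \<open>v\<close> does, whereas the
  induced norm is a supremum over all vectors. If \<open>v\<close> has zero entries, the two suprema can differ
  unless the norm does not increase under the following projection. This is automatic if \<open>v\<close> has no
  zero entry, and it holds for every absolute norm, such as all \<open>p\<close>-norms.\<close>

definition zero_off_support :: "real^'a \<Rightarrow> real^'a \<Rightarrow> real^'a" where
  "zero_off_support v y = (\<chi> i. if v $ i = 0 then 0 else y $ i)"

lemma zero_off_support_nonzero:
  fixes mu :: "real^'a \<Rightarrow> real"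
  assumes "\<And>i. v $ i \<noteq> 0"
  shows "mu (zero_off_support v y) \<le> mu y"
  using assms by (simp add: zero_off_support_def)

lemma zero_off_support_absolute:
  assumes "is_vector_norm mu" and abs: "\<And>y. mu (\<chi> i. \<bar>y $ i\<bar>) = mu y"
  shows "mu (zero_off_support v y) \<le> mu y"
proof -
  define z where "z = (\<chi> i. if v $ i = 0 then - y $ i else y $ i)"
  have "(\<chi> i. \<bar>z $ i\<bar>) = (\<chi> i. \<bar>y $ i\<bar>)" by (simp add: z_def vec_eq_iff)
  then have z: "mu z = mu y" by (metis abs)
  have "zero_off_support v y = (1/2) *\<^sub>R (y + z)"
    by (simp add: zero_off_support_def z_def vec_eq_iff)
  then have "mu (zero_off_support v y) = \<bar>1/2\<bar> * mu (y + z)"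
    using assms(1) unfolding is_vector_norm_def by metis
  moreover have "mu (y + z) \<le> mu y + mu z"
    using assms(1) unfolding is_vector_norm_def by blast
  ultimately show ?thesis using z by simp
qed

end

theory Submission
  imports Defs
begin

text \<open>By Cramer's rule the solution \<open>s(z)\<close> of a linear system \<open>F(z) s(z) = c(z)\<close> is differentiable
  in \<open>z\<close> wherever \<open>F(z)\<close> is invertible, and differentiating the system gives
  \<open>s' = F\<inverse> (c' - F' s)\<close>. For the normal equations \<open>A\<^sup>T J A x = A\<^sup>T J b\<close> this derivative, written as
  a matrix acting on the stacked perturbation, is the matrix \<open>M_g'\<close>. Multiplication by the diagonal
  matrix of the parameters inverts the scaling of admissible perturbations. The vectors that do not
  arise as scaled perturbations are those not supported where the parameters are nonzero; projecting
  them to that support does not change the numerator and does not increase the denominator.\<close>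

section \<open>Bilinearity of matrix products, and the action of block matrices on stacked
  vectors\<close>

lemma bounded_bilinear_matrix_vector_mult:
  "bounded_bilinear ((*v) :: real^'n^'m \<Rightarrow> real^'n \<Rightarrow> real^'m)"
  unfolding bilinear_conv_bounded_bilinear[symmetric]
  by (simp add: bilinear_def linear_iff matrix_vector_right_distrib matrix_vector_mult_add_rdistrib
      matrix_vector_mult_scaleR scaleR_matrix_vector_assoc)

lemma bounded_bilinear_matrix_mult:
  "bounded_bilinear ((**) :: real^'n^'m \<Rightarrow> real^'k^'n \<Rightarrow> real^'k^'m)"
  unfolding bilinear_conv_bounded_bilinear[symmetric] bilinear_def linear_iff
  by (simp add: matrix_matrix_mult_def vec_eq_iff distrib_left distrib_right sum.distrib
       sum_distrib_left mult_ac)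

lemma bounded_linear_transpose:
  "bounded_linear (transpose :: real^'n^'m \<Rightarrow> real^'m^'n)"
  unfolding linear_conv_bounded_linear[symmetric]
  by (simp add: linear_iff transpose_def vec_eq_iff)

text \<open>The case \<open>B = u\<close> of the identity
  \<open>vec (C X B) = (B\<^sup>T \<otimes> C) vec X\<close>; both sides are one double sum, summed
  in different orders.\<close>

lemma row_kron_vec_mat:
  "row_kron u C *v vec_mat X = C *v (X *v u)"
proof -
  have "(row_kron u C *v vec_mat X) $ i = (C *v (X *v u)) $ i" for i
  proof -
    have "(row_kron u C *v vec_mat X) $ i
        = (\<Sum>(j, l)\<in>UNIV \<times> UNIV. C $ i $ l * (X $ l $ j * u $ j))"
      by (simp add: row_kron_def kron_def vec_mat_def matrix_vector_mult_def rowvector_def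
          case_prod_beta mult_ac)
    also have "\<dots> = (C *v (X *v u)) $ i"
      unfolding sum.cartesian_product[symmetric]
      by (subst sum.swap) (simp add: matrix_vector_mult_def sum_distrib_left)
    finally show ?thesis .
  qed
  then show ?thesis by (simp add: vec_eq_iff)
qed

lemma hcat_vec_pair:
  "hcat P Q *v vec_pair X c = P *v vec_mat X + Q *v c"
  by (simp add: hcat_def vec_pair_def matrix_vector_mult_def vec_eq_iff UNIV_Plus_UNIV[symmetric]
      sum.Plus del: UNIV_Plus_UNIV)

lemma diag_mult_vector: "(diag v *v y) $ i = v $ i * y $ i"
  by (simp add: diag_def matrix_vector_mult_def if_distrib[of "\<lambda>t. t * _"] cong: if_cong)

lemma vec_pair_cases:
  obtains X c where "y = vec_pair X c"
proof
  show "y = vec_pair (\<chi> i j. y $ Inl (j, i)) (\<chi> i. y $ Inr i)"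
    by (simp add: vec_eq_iff vec_pair_def vec_mat_def split: sum.split)
qed

section \<open>Differentiability of solutions of linear systems\<close>

lemma differentiable_det:
  fixes F :: "'a::real_normed_vector \<Rightarrow> real^'n^'n"
  assumes "\<And>i j. (\<lambda>z. F z $ i $ j) differentiable (at x)"
  shows "(\<lambda>z. det (F z)) differentiable (at x)"
proof -
  obtain D where D: "((\<lambda>z. F z $ i $ j) has_derivative D i j) (at x)" for i j
    using assms unfolding differentiable_def by metis
  \<comment> \<open>These products, over permutations \<open>p\<close>, are the terms of the Leibniz
    formula up to sign.\<close>
  have "(\<lambda>z. \<Prod>i\<in>UNIV. F z $ i $ p i) differentiable (at x)" for p
    unfolding differentiable_def by (rule exI, rule has_derivative_prod, rule D)
  then show ?thesis
    unfolding det_def by (intro differentiable_sum differentiable_mult differentiable_const) auto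
qed

lemma differentiable_vec_nth:
  assumes "f differentiable (at x)"
  shows "(\<lambda>z. f z $ i) differentiable (at x)"
  using assms bounded_linear.has_derivative[OF bounded_linear_vec_nth]
  unfolding differentiable_def by blast

lemma matrix_inv_mult:
  fixes M :: "real^'n^'n"
  assumes "invertible M"
  shows "M ** matrix_inv M = mat 1" "matrix_inv M ** M = mat 1"
  using someI_ex[OF assms[unfolded invertible_def]] unfolding matrix_inv_def by auto

text \<open>The filter \<open>nhds x\<close>, unlike the punctured one, also gives agreement at
  \<open>x\<close> itself, whose value enters the difference quotient.\<close>

lemma has_derivative_cong_nhds:
  assumes "(f has_derivative f') (at x)" and "eventually (\<lambda>z. f z = g z) (nhds x)"
  shows "(g has_derivative f') (at x)"
  using assms eventually_nhds_x_imp_x[OF assms(2)]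
  by (intro has_derivative_transform_eventually[of f f' x UNIV g]) 
    (auto simp: eventually_at_filter elim: eventually_mono)

text \<open>Invertibility means a nonzero determinant, and the determinant is continuous here.
  Identities involving \<open>matrix_inv (F z)\<close> thus hold in a neighbourhood of
  \<open>x\<close>.\<close>

lemma eventually_invertible:
  fixes F :: "'a::real_normed_vector \<Rightarrow> real^'n^'n"
  assumes F: "F differentiable (at x)" and inv: "invertible (F x)"
  shows "eventually (\<lambda>z. invertible (F z)) (nhds x)"
proof -
  have "(\<lambda>z. det (F z)) differentiable (at x)"
    by (intro differentiable_det differentiable_vec_nth F)
  then have "isCont (\<lambda>z. det (F z)) x"
    by (rule differentiable_imp_continuous_within)
  then show ?thesis
    using inv continuous_at_avoid[of x "\<lambda>z. det (F z)" 0]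
    by (auto simp: invertible_det_nz eventually_nhds_metric dist_commute)
qed

lemma differentiable_linear_solve:
  fixes F :: "'a::real_normed_vector \<Rightarrow> real^'n^'n" and c :: "'a \<Rightarrow> real^'n"
  assumes F: "F differentiable (at x)" and c: "c differentiable (at x)"
    and inv: "invertible (F x)"
  shows "(\<lambda>z. matrix_inv (F z) *v c z) differentiable (at x)"
proof -
  \<comment> \<open>Cramer's formula: column \<open>k\<close> is replaced by the right-hand side.
    Unlike \<open>matrix_inv\<close>, it is visibly differentiable.\<close>
  let ?s = "\<lambda>z. (\<chi> k. det (\<chi> i j. if j = k then c z $ i else F z $ i $ j) / det (F z)) :: real^'n"
  have det: "(\<lambda>z. det (F z)) differentiable (at x)"
    by (intro differentiable_det differentiable_vec_nth F)
  have "(\<lambda>z. if j = k then c z $ i else F z $ i $ j) differentiable (at x)" for i j k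
    by (cases "j = k") (simp_all add: differentiable_vec_nth F c)
  then have "(\<lambda>z. det (\<chi> i j. if j = k then c z $ i else F z $ i $ j)) differentiable (at x)" for k
    by (intro differentiable_det) simp
  then have "(\<lambda>z. ?s z $ k) differentiable (at x)" for k
    using inv by (simp add: differentiable_divide det invertible_det_nz)
  then have s: "?s differentiable (at x)"
    unfolding differentiable_componentwise_within[of ?s] by (auto simp: Basis_vec_def inner_axis)
  have eq: "?s z = matrix_inv (F z) *v c z" if "invertible (F z)" for z
  proof -
    have "F z *v (matrix_inv (F z) *v c z) = c z"
      using that by (simp add: matrix_vector_mul_assoc matrix_inv_mult)
    then show ?thesis
      using that cramer[of "F z"] by (auto simp: invertible_det_nz)
  qed
  have "eventually (\<lambda>z. ?s z = matrix_inv (F z) *v c z) (nhds x)"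
    using eventually_invertible[OF F inv] by (rule eventually_mono) (rule eq)
  with s show "(\<lambda>z. matrix_inv (F z) *v c z) differentiable (at x)"
    unfolding differentiable_def
    by (blast intro: has_derivative_cong_nhds)
qed

lemma has_derivative_linear_solve:
  fixes F :: "'a::real_normed_vector \<Rightarrow> real^'n^'n" and c :: "'a \<Rightarrow> real^'n"
  assumes F: "(F has_derivative F') (at x)" and c: "(c has_derivative c') (at x)"
    and inv: "invertible (F x)"
  shows "((\<lambda>z. matrix_inv (F z) *v c z) has_derivative
      (\<lambda>h. matrix_inv (F x) *v (c' h - F' h *v (matrix_inv (F x) *v c x)))) (at x)"
proof -
  let ?s = "\<lambda>z. matrix_inv (F z) *v c z"
  have diff: "F differentiable (at x)" "c differentiable (at x)"
    using F c by (auto simp: differentiable_def)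
  obtain s' where s': "(?s has_derivative s') (at x)"
    using differentiable_linear_solve[OF diff inv] by (auto simp: differentiable_def)
  \<comment> \<open>The product rule on the left of the system; uniqueness of the derivative of
    \<open>c\<close> then yields a linear equation for \<open>s' h\<close>.\<close>
  have "((\<lambda>z. F z *v ?s z) has_derivative (\<lambda>h. F x *v s' h + F' h *v ?s x)) (at x)"
    by (rule bounded_bilinear.FDERIV[OF bounded_bilinear_matrix_vector_mult F s'])
  moreover have "eventually (\<lambda>z. F z *v ?s z = c z) (nhds x)"
    using eventually_invertible[OF diff(1) inv]
    by eventually_elim (simp add: matrix_vector_mul_assoc matrix_inv_mult)
  ultimately have "(c has_derivative (\<lambda>h. F x *v s' h + F' h *v ?s x)) (at x)"
    by (rule has_derivative_cong_nhds)
  then have "c' h = F x *v s' h + F' h *v ?s x" for h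
    using has_derivative_unique[OF c] by metis
  then have "F x *v s' h = c' h - F' h *v ?s x" for h
    by simp
  then have "s' h = matrix_inv (F x) *v (c' h - F' h *v ?s x)" for h
    using inv by (metis matrix_vector_mul_assoc matrix_inv_mult(2) matrix_vector_mul_lid)
  then show ?thesis using s' by presburger
qed

section \<open>The derivative of the ILS solution map and its matrix\<close>

lemma pos_def_imp_invertible:
  assumes "pos_def M" shows "invertible M"
  \<comment> \<open>A kernel vector \<open>z\<close> gives \<open>z \<bullet> (M *v z) = 0\<close>,
    so it is zero.\<close>
  unfolding invertible_left_inverse matrix_left_invertible_ker
  using assms unfolding pos_def_def by (metis inner_zero_right less_irrefl)

text \<open>Differentiating the normal equations produces \<open>transpose dA\<close> applied to
  \<open>J *v b\<close> on the right and to \<open>J *v (A *v x)\<close> on the left; their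
  difference is the residual term.\<close>

lemma ils_g_has_derivative:
  fixes A :: "real^'n^'m" and b :: "real^'m" and L :: "real^'k^'n" and J :: "real^'m^'m"
  assumes inv: "invertible (ils_M J A)"
  defines "Mi \<equiv> matrix_inv (ils_M J A)" and "x \<equiv> ils_sol J A b"
  shows "(ils_g J L has_derivative
      (\<lambda>(dA, db). transpose L *v (Mi *v (transpose dA *v (J *v (b - A *v x))
        - transpose A *v (J *v (dA *v x)) + transpose A *v (J *v db))))) (at (A, b))"
proof -
  note bil = bounded_bilinear.FDERIV[OF bounded_bilinear_matrix_mult]
  note bilv = bounded_bilinear.FDERIV[OF bounded_bilinear_matrix_vector_mult]
  have A: "((\<lambda>z :: (real^'n^'m) \<times> (real^'m). fst z) has_derivative fst) (at (A, b))"
    and b: "((\<lambda>z :: (real^'n^'m) \<times> (real^'m). snd z) has_derivative snd) (at (A, b))"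
    by (auto intro!: derivative_eq_intros)
  note AT = bounded_linear.has_derivative[OF bounded_linear_transpose A]
  note ATJ = bil[OF AT has_derivative_const[of J]]
  note M = bil[OF ATJ A]
  note c = bilv[OF ATJ b]
  have inv': "invertible (transpose (fst (A, b)) ** J ** fst (A, b))"
    using inv by (simp add: ils_M_def)
  note s = has_derivative_linear_solve[OF M c inv']
  note g = bounded_linear.has_derivative[OF matrix_vector_mul_bounded_linear[of "transpose L"] s]
  have "(\<lambda>z. transpose L *v (matrix_inv (transpose (fst z) ** J ** fst z)
      *v ((transpose (fst z) ** J) *v snd z))) = ils_g J L"
    by (auto simp: ils_g_def ils_sol_def ils_M_def matrix_vector_mul_assoc matrix_mul_assoc)
  note g' = g[unfolded this]
  have "matrix_inv (transpose A ** J ** A) = Mi" "Mi *v ((transpose A ** J) *v b) = x"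
    by (simp_all add: Mi_def x_def ils_M_def ils_sol_def matrix_vector_mul_assoc matrix_mul_assoc)
  note g'' = g'[unfolded fst_conv snd_conv this]
  show ?thesis
    by (rule has_derivative_eq_rhs[OF g''])
      (auto simp: fun_eq_iff matrix_vector_mult_add_rdistrib matrix_vector_mul_assoc[symmetric]
        matrix_vector_right_distrib matrix_vector_mult_diff_distrib)
qed

text \<open>\<open>vec_perm\<close> supplies \<open>transpose dA\<close> for the residual term, the
  second Kronecker product gives the term in \<open>dA *v x\<close>, and the last block gives the
  term in \<open>db\<close>.\<close>

lemma M_g'_vec_pair:
  fixes A :: "real^'n^'m" and b :: "real^'m" and L :: "real^'k^'n" and J :: "real^'m^'m"
  assumes inv: "invertible (ils_M J A)"
  shows "M_g' J L A b *v vec_pair dA db = frechet_derivative (ils_g J L) (at (A, b)) (dA, db)"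
  unfolding frechet_derivative_at[OF ils_g_has_derivative[OF inv], symmetric]
  by (simp add: M_g'_def Let_def hcat_vec_pair matrix_vector_mult_diff_rdistrib
      matrix_vector_mul_assoc[symmetric] vec_perm_vec_mat row_kron_vec_mat
      matrix_vector_right_distrib matrix_vector_mult_diff_distrib)

section \<open>Scaling of perturbations, and comparison of the two suprema\<close>

lemma vdiv_nth: "vdiv a v $ i = ddag (v $ i) * a $ i"
  by (simp add: vdiv_def diag_ddag_def diag_mult_vector)

lemma vec_pair_scaled_nth:
  "vec_pair (mdiv X Y) (vdiv c v) $ d = ddag (vec_pair Y v $ d) * vec_pair X c $ d"
  by (cases d) (simp_all add: vec_pair_def vec_mat_def mdiv_def vdiv_nth)

lemma vec_pair_admissible:
  "(\<forall>i j. Y $ i $ j = 0 \<longrightarrow> X $ i $ j = 0) \<and> (\<forall>i. v $ i = 0 \<longrightarrow> c $ i = 0) \<longleftrightarrow>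
   (\<forall>d. vec_pair Y v $ d = 0 \<longrightarrow> vec_pair X c $ d = 0)"
proof
  assume adm: "\<forall>d. vec_pair Y v $ d = 0 \<longrightarrow> vec_pair X c $ d = 0"
  show "(\<forall>i j. Y $ i $ j = 0 \<longrightarrow> X $ i $ j = 0) \<and> (\<forall>i. v $ i = 0 \<longrightarrow> c $ i = 0)"
    \<comment> \<open>The indices are swapped because columns are stacked.\<close>
    using adm[rule_format, of "Inl (j, i)" for i j] adm[rule_format, of "Inr i" for i]
    by (simp add: vec_pair_def vec_mat_def)
qed (auto simp: vec_pair_def vec_mat_def split: sum.split)

theorem theorem3p1:
  fixes A :: "real^'n^'m" and b :: "real^'m" and L :: "real^'k^'n"
    and rho :: "'m \<Rightarrow> nat" and p q :: nat and J :: "real^'m^'m"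
    and Psi :: "real^'n^'m" and beta :: "real^'m" and xi :: "real^'k"
    and mu :: "real^(('n \<times> 'm) + 'm) \<Rightarrow> real" and nu :: "real^'k \<Rightarrow> real"
  assumes "CARD('n) \<le> CARD('m)" and "CARD('k) \<le> CARD('n)"
    and "p + q = CARD('m)" and "bij_betw rho UNIV {..<CARD('m)}" and "J = signature rho p"
    and "pos_def (ils_M J A)"
    and "is_vector_norm mu" and "is_vector_norm nu"
    and "\<And>y. mu (zero_off_support (vec_pair Psi beta) y) \<le> mu y"
  shows "kappa_ILS mu nu Psi beta xi J L A b =
         induced_norm mu nu (diag_ddag xi ** M_g' J L A b ** diag (vec_pair Psi beta))"
proof -
  define v where "v = vec_pair Psi beta"
  define N where "N = diag_ddag xi ** M_g' J L A b ** diag v"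
  define D where "D = frechet_derivative (ils_g J L) (at (A, b))"
  define sc where "sc dA db = vec_pair (mdiv dA Psi) (vdiv db beta)"
    for dA :: "real^'n^'m" and db :: "real^'m"
  define adm where "adm dA db \<longleftrightarrow> (\<forall>i j. Psi $ i $ j = 0 \<longrightarrow> dA $ i $ j = 0) \<and>
      (\<forall>i. beta $ i = 0 \<longrightarrow> db $ i = 0)"
    for dA :: "real^'n^'m" and db :: "real^'m"
  have adm: "adm dA db \<longleftrightarrow> (\<forall>d. v $ d = 0 \<longrightarrow> vec_pair dA db $ d = 0)" for dA db
    unfolding adm_def v_def by (rule vec_pair_admissible)
  have sc: "sc dA db $ d = ddag (v $ d) * vec_pair dA db $ d" for dA db d
    unfolding sc_def v_def by (rule vec_pair_scaled_nth)
  have N: "N *v y = vdiv (D (dA, db)) xi" if "diag v *v y = vec_pair dA db" for y dA db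
    using that M_g'_vec_pair[OF pos_def_imp_invertible[OF assms(6)], of L b dA db]
    by (simp add: N_def D_def vdiv_def matrix_vector_mul_assoc[symmetric])
  have mu_nonneg: "mu y \<ge> 0" and mu0: "mu y = 0 \<longleftrightarrow> y = 0"
    and nu_nonneg: "nu w \<ge> 0" and nu0: "nu w = 0 \<longleftrightarrow> w = 0" for y w
    using assms(7,8) unfolding is_vector_norm_def by blast+
  have kappa: "kappa_ILS mu nu Psi beta xi J L A b =
      (SUP (dA, db) \<in> {(dA, db). adm dA db \<and> mu (sc dA db) \<noteq> 0}.
        ennreal (nu (vdiv (D (dA, db)) xi) / mu (sc dA db)))"
    unfolding kappa_ILS_def adm_def sc_def D_def by (simp only: conj_assoc)
  have norm: "induced_norm mu nu N = (SUP y \<in> {y. y \<noteq> 0}. ennreal (nu (N *v y) / mu y))"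
    by (simp add: induced_norm_def)
  have "kappa_ILS mu nu Psi beta xi J L A b \<le> induced_norm mu nu N"
    unfolding kappa
  proof (rule SUP_least, clarsimp)
    fix dA db assume *: "adm dA db" "mu (sc dA db) \<noteq> 0"
    \<comment> \<open>Where \<open>v\<close> vanishes, admissibility makes both sides zero;
      elsewhere \<open>v\<close> cancels its reciprocal.\<close>
    have "diag v *v sc dA db = vec_pair dA db"
      using *(1) by (auto simp: vec_eq_iff diag_mult_vector sc adm ddag_def)
    then have "ennreal (nu (vdiv (D (dA, db)) xi) / mu (sc dA db))
        = ennreal (nu (N *v sc dA db) / mu (sc dA db))"
      by (simp add: N)
    also have "\<dots> \<le> induced_norm mu nu N"
      unfolding norm using *(2) by (intro SUP_upper) (simp add: mu0)
    finally show "ennreal (nu (vdiv (D (dA, db)) xi) / mu (sc dA db)) \<le> induced_norm mu nu N" .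
  qed
  moreover have "induced_norm mu nu N \<le> kappa_ILS mu nu Psi beta xi J L A b"
    unfolding norm
  proof (rule SUP_least, clarsimp)
    fix y :: "real^(('n \<times> 'm) + 'm)" assume "y \<noteq> 0"
    define z where "z = zero_off_support v y"
    \<comment> \<open>Unscaling \<open>y\<close> gives an admissible perturbation; scaling it again
      returns only the projection \<open>z\<close> of \<open>y\<close>.\<close>
    obtain dA db where d: "diag v *v y = vec_pair dA db"
      by (rule vec_pair_cases)
    have d_nth: "vec_pair dA db $ i = v $ i * y $ i" for i
      by (simp add: d[symmetric] diag_mult_vector)
    have z: "sc dA db = z"
      by (simp add: vec_eq_iff sc d_nth z_def zero_off_support_def ddag_def)
    have adm': "adm dA db"
      by (simp add: adm d_nth)
    show "ennreal (nu (N *v y) / mu y) \<le> kappa_ILS mu nu Psi beta xi J L A b"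
    proof (cases "z = 0")
      \<comment> \<open>This perturbation is excluded from the supremum by its zero denominator, but
        the quotient for \<open>y\<close> is then 0.\<close>
      case True
      then have "v $ i * y $ i = 0" for i
        by (auto simp: z_def zero_off_support_def vec_eq_iff split: if_splits)
      then have "diag v *v y = 0"
        by (simp add: vec_eq_iff diag_mult_vector)
      then have "N *v y = 0"
        by (simp add: N_def matrix_vector_mul_assoc[symmetric])
      then have "nu (N *v y) = 0"
        by (simp add: nu0)
      then show ?thesis by simp
    next
      case False
      then have "0 < mu z"
        using mu_nonneg[of z] mu0[of z] by simp
      moreover have "mu z \<le> mu y"
        using assms(9) by (simp add: z_def v_def)
      ultimately have "nu (N *v y) / mu y \<le> nu (vdiv (D (dA, db)) xi) / mu (sc dA db)"
        unfolding N[OF d] z by (intro divide_left_mono nu_nonneg) simp_all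
      then have "ennreal (nu (N *v y) / mu y) \<le> ennreal (nu (vdiv (D (dA, db)) xi) / mu (sc dA db))"
        by (rule ennreal_leI)
      also have "\<dots> \<le> kappa_ILS mu nu Psi beta xi J L A b"
        unfolding kappa using adm' \<open>0 < mu z\<close> z by (intro SUP_upper2[of "(dA, db)"]) auto
      finally show ?thesis .
    qed
  qed
  ultimately show ?thesis
    unfolding N_def v_def by (rule antisym)
qed

end
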